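(* Let $G=(V,E)$ be a graph of order $p$ with $V=\{v_1,v_2,\ldots,v_p\}$. The following statements are equivalent. (i) $G$ is $3$-colorable. (ii) $G$ has a $(1,2)$-uniform directional adjacency matrix.
   Context: Graphs are simple and undirected. A graph $G=(V,E)$ is called $3$-colorable if its vertices can be colored with $3$ colors such that no two adjacent vertices receive the same color, and this is not possible with $2$ colors. A directional adjacency matrix (d.a. matrix) of $G$ is a matrix $M=[a_{ij}]$ of order $p$ such that, for any two vertices $v_i,v_j$, $a_{ij}=1$ or $-1$ if $v_iv_j$ is an edge of $G$, and $a_{ij}=0$ if $v_i$ and $v_j$ are not adjacent. For an edge $v_iv_j$, both $a_{ij}=a_{ji}$ and $a_{ij}=-a_{ji}$ are allowed. Write $r_M(i)=1$ if all nonzero entries in the $i$-th row of $M$ are $1$; $r_M(i)=-1$ if all nonzero entries in the $i$-th row are $-1$; and $r_M(i)=\{1,-1\}$ if the nonzero entries in the $i$-th row include both $1$ and $-1$. The d.a. matrix $M$ is $(1,2)$-uniform if for any two adjacent vertices, named $v_i$ and $v_j$ in a suitable order, one of the following holds: (i) $r_M(i)=1$ and $r_M(j)=-1$; (ii) $r_M(i)=1$ and $r_M(j)=\{1,-1\}$; (iii) $r_M(i)=-1$ and $r_M(j)=\{1,-1\}$.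
   Formalization: With "3-colorable" excluding 2-colorable graphs, (ii) does not imply (i) (e.g. a single edge); proved instead: G is colorable with 3 colors iff (ii), and, if G is not colorable with 2 colors, (i) iff (ii). *)

theory Defs
  imports "Jordan_Normal_Form.Matrix"
begin

definition simple_graph :: "'a set \<Rightarrow> 'a set set \<Rightarrow> bool" where
  "simple_graph V E \<longleftrightarrow> (\<forall>e\<in>E. e \<subseteq> V \<and> card e = 2)"

definition colorable_with :: "'a set \<Rightarrow> 'a set set \<Rightarrow> nat \<Rightarrow> bool" where
  "colorable_with V E k \<longleftrightarrow>
     (\<exists>c :: 'a \<Rightarrow> nat. (\<forall>u\<in>V. c u < k) \<and>
        (\<forall>u\<in>V. \<forall>w\<in>V. {u, w} \<in> E \<longrightarrow> c u \<noteq> c w))"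

(* 3-colorability in the sense "three colors suffice and two do not"; the usual notion is
   colorable_with V E 3. *)
definition three_colorable :: "'a set \<Rightarrow> 'a set set \<Rightarrow> bool" where
  "three_colorable V E \<longleftrightarrow> colorable_with V E 3 \<and> \<not> colorable_with V E 2"

(* The vertices are enumerated as v 0, ..., v (p - 1), matching the row and column indices
   of a p x p matrix. M need not be symmetric. *)
definition da_matrix :: "nat \<Rightarrow> (nat \<Rightarrow> 'a) \<Rightarrow> 'a set set \<Rightarrow> int mat \<Rightarrow> bool" where
  "da_matrix p v E M \<longleftrightarrow> M \<in> carrier_mat p p \<and>
     (\<forall>i<p. \<forall>j<p.
        ({v i, v j} \<in> E \<longrightarrow> M $$ (i, j) = 1 \<or> M $$ (i, j) = -1) \<and>
        ({v i, v j} \<notin> E \<longrightarrow> M $$ (i, j) = 0))"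

(* The three possible values 1, -1 and {1,-1} of r_M(i) are rendered as predicates. For a zero
   row (an isolated vertex) the first two both hold vacuously, so r_M is not a function there. *)
definition row_pos :: "int mat \<Rightarrow> nat \<Rightarrow> bool" where
  "row_pos M i \<longleftrightarrow> (\<forall>j<dim_col M. M $$ (i, j) \<noteq> 0 \<longrightarrow> M $$ (i, j) = 1)"

definition row_neg :: "int mat \<Rightarrow> nat \<Rightarrow> bool" where
  "row_neg M i \<longleftrightarrow> (\<forall>j<dim_col M. M $$ (i, j) \<noteq> 0 \<longrightarrow> M $$ (i, j) = -1)"

definition row_mixed :: "int mat \<Rightarrow> nat \<Rightarrow> bool" where
  "row_mixed M i \<longleftrightarrow>
     (\<exists>j<dim_col M. M $$ (i, j) = 1) \<and> (\<exists>j<dim_col M. M $$ (i, j) = -1)"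

definition row_types_compatible :: "int mat \<Rightarrow> nat \<Rightarrow> nat \<Rightarrow> bool" where
  "row_types_compatible M i j \<longleftrightarrow>
     row_pos M i \<and> row_neg M j \<or>
     row_pos M i \<and> row_mixed M j \<or>
     row_neg M i \<and> row_mixed M j"

(* The disjunction over the two orders, chosen separately for each edge, expresses that the
   endpoints are named in a suitable order. *)
definition uniform_1_2 :: "nat \<Rightarrow> (nat \<Rightarrow> 'a) \<Rightarrow> 'a set set \<Rightarrow> int mat \<Rightarrow> bool" where
  "uniform_1_2 p v E M \<longleftrightarrow>
     (\<forall>i<p. \<forall>j<p. {v i, v j} \<in> E \<longrightarrow>
        row_types_compatible M i j \<or> row_types_compatible M j i)"

definition has_uniform_1_2_da_matrix :: "nat \<Rightarrow> (nat \<Rightarrow> 'a) \<Rightarrow> 'a set set \<Rightarrow> bool" where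
  "has_uniform_1_2_da_matrix p v E \<longleftrightarrow> (\<exists>M. da_matrix p v E M \<and> uniform_1_2 p v E M)"

end

theory Submission
  imports Defs
begin

text \<open>
  The three row types \<open>1\<close>, \<open>-1\<close> and \<open>{1,-1}\<close> act as three colors, and compatibility of the rows of
  adjacent vertices says that their types differ.

  From a matrix to a coloring this is immediate: only a zero row has two types, and a vertex with a
  zero row is on no edge (\<open>colorable_if_uniform_matrix\<close>).

  From a coloring with colors 0, 1, 2 to a matrix, give the rows of color 0 the entries 1 and the
  rows of color 1 the entries -1. A row of color 2 has to contain both signs, which needs two
  neighbors, so an arbitrary coloring will not do: a leaf may have color 2. The coloring is
  therefore first changed so that each vertex of color 2 sees both other colors
  (\<open>ex_coloring_reluctant_2\<close>). Such a row can then take the entry 1 at its neighbors of color 0 and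
  -1 at its neighbors of color 1.
\<close>

text \<open>
  A vertex of color 2 that misses one of the colors 0, 1 among its neighbors can take the missing
  color. All these vertices can be recolored at once: they are pairwise nonadjacent, and the
  vertices of colors 0 and 1, which are the witnesses for the vertices left with color 2, keep their
  colors.
\<close>

lemma ex_coloring_reluctant_2:
  assumes "colorable_with V E 3"
  obtains c :: "'a \<Rightarrow> nat"
  where "\<And>u. u \<in> V \<Longrightarrow> c u < 3"
    and "\<And>u w. u \<in> V \<Longrightarrow> w \<in> V \<Longrightarrow> {u, w} \<in> E \<Longrightarrow> c u \<noteq> c w"
    and "\<And>u a. u \<in> V \<Longrightarrow> c u = 2 \<Longrightarrow> a < 2 \<Longrightarrow> \<exists>w\<in>V. {u, w} \<in> E \<and> c w = a"
proof -
  obtain d :: "'a \<Rightarrow> nat" where d_less: "\<And>u. u \<in> V \<Longrightarrow> d u < 3"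
    and d_proper: "\<And>u w. u \<in> V \<Longrightarrow> w \<in> V \<Longrightarrow> {u, w} \<in> E \<Longrightarrow> d u \<noteq> d w"
    using assms unfolding colorable_with_def by blast
  define sees where "sees u a \<longleftrightarrow> (\<exists>w\<in>V. {u, w} \<in> E \<and> d w = a)" for u a
  define c where "c u = (if d u \<noteq> 2 then d u else if \<not> sees u 0 then 0
      else if \<not> sees u 1 then 1 else 2)" for u
  have c_avoids: "c u \<noteq> d w" if "u \<in> V" "w \<in> V" "{u, w} \<in> E" for u w
    using d_proper[OF that] that unfolding c_def sees_def by auto
  show thesis
  proof
    show "c u < 3" if "u \<in> V" for u
      using d_less[OF that] by (simp add: c_def)
  next
    fix u w assume uw: "u \<in> V" "w \<in> V" "{u, w} \<in> E"
    then have wu: "{w, u} \<in> E" by (simp add: insert_commute)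
    (* One endpoint does not have the old color 2, so its color is unchanged. *)
    have "c u = d u \<or> c w = d w"
      using d_proper[OF uw] by (auto simp: c_def)
    then show "c u \<noteq> c w"
      using c_avoids[OF uw] c_avoids[OF uw(2,1) wu] by auto
  next
    fix u and a :: nat assume "u \<in> V" "c u = 2" "a < 2"
    then have "sees u a"
      by (auto simp: c_def less_2_cases_iff split: if_splits)
    then obtain w where "w \<in> V" "{u, w} \<in> E" "d w = a"
      unfolding sees_def by blast
    moreover have "c w = d w"
      using \<open>d w = a\<close> \<open>a < 2\<close> by (simp add: c_def)
    ultimately show "\<exists>w\<in>V. {u, w} \<in> E \<and> c w = a" by auto
  qed
qed

lemma uniform_matrix_if_colorable:
  assumes v: "v ` {..<p} = V" and "colorable_with V E 3"
  shows "has_uniform_1_2_da_matrix p v E"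
proof -
  obtain c :: "'a \<Rightarrow> nat" where c_less: "\<And>u. u \<in> V \<Longrightarrow> c u < 3"
    and proper: "\<And>u w. u \<in> V \<Longrightarrow> w \<in> V \<Longrightarrow> {u, w} \<in> E \<Longrightarrow> c u \<noteq> c w"
    and sees: "\<And>u a. u \<in> V \<Longrightarrow> c u = 2 \<Longrightarrow> a < 2 \<Longrightarrow> \<exists>w\<in>V. {u, w} \<in> E \<and> c w = a"
    using ex_coloring_reluctant_2[OF assms(2)] by metis
  define M :: "int mat" where "M = mat p p (\<lambda>(i, j).
      if {v i, v j} \<notin> E then 0
      else if c (v i) = 0 \<or> c (v i) = 2 \<and> c (v j) = 0 then 1 else -1)"
  have in_V: "v i \<in> V" if "i < p" for i using v that by auto
  have pos: "row_pos M i" if "i < p" "c (v i) = 0" for i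
    using that by (auto simp: row_pos_def M_def)
  have neg: "row_neg M i" if "i < p" "c (v i) = 1" for i
    using that by (auto simp: row_neg_def M_def)
  have mixed: "row_mixed M i" if "i < p" "c (v i) = 2" for i
  proof -
    have nbr: "\<exists>j<p. {v i, v j} \<in> E \<and> c (v j) = a" if "a < 2" for a
      using sees[OF in_V[OF \<open>i < p\<close>] \<open>c (v i) = 2\<close> that] v by auto
    obtain j k where "j < p" "{v i, v j} \<in> E" "c (v j) = 0"
      and "k < p" "{v i, v k} \<in> E" "c (v k) = 1"
      using nbr[of 0] nbr[of 1] by auto
    then have "M $$ (i, j) = 1" "M $$ (i, k) = -1"
      using that by (simp_all add: M_def)
    then show ?thesis
      using \<open>j < p\<close> \<open>k < p\<close> unfolding row_mixed_def by (auto simp: M_def)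
  qed
  have "da_matrix p v E M"
    by (auto simp: da_matrix_def M_def)
  moreover have "uniform_1_2 p v E M"
    unfolding uniform_1_2_def
  proof (intro allI impI)
    fix i j assume ij: "i < p" "j < p" and "{v i, v j} \<in> E"
    then have "c (v i) \<noteq> c (v j)" using proper in_V by blast
    moreover have "c (v i) \<in> {0, 1, 2}" "c (v j) \<in> {0, 1, 2}"
      using c_less[OF in_V] ij by (fastforce simp: numeral_3_eq_3)+
    ultimately show "row_types_compatible M i j \<or> row_types_compatible M j i"
      using pos neg mixed ij unfolding row_types_compatible_def by auto
  qed
  ultimately show ?thesis unfolding has_uniform_1_2_da_matrix_def by blast
qed

lemma colorable_if_uniform_matrix:
  assumes v: "v ` {..<p} = V" and "has_uniform_1_2_da_matrix p v E"
  shows "colorable_with V E 3"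
proof -
  obtain M where M: "da_matrix p v E M" and uniform: "uniform_1_2 p v E M"
    using assms(2) unfolding has_uniform_1_2_da_matrix_def by blast
  define f :: "nat \<Rightarrow> nat" where
    "f i = (if row_pos M i then 0 else if row_neg M i then 1 else 2)" for i
  have dim: "dim_col M = p" using M by (auto simp: da_matrix_def)
  have f_eq: "(row_pos M i \<longrightarrow> f i = 0) \<and> (row_neg M i \<longrightarrow> f i = 1) \<and> (row_mixed M i \<longrightarrow> f i = 2)"
    if "i < p" "j < p" "{v i, v j} \<in> E" for i j
  proof -
    (* The nonzero entry at j keeps a row from being both positive and negative. *)
    have "M $$ (i, j) \<noteq> 0" using M that by (force simp: da_matrix_def)
    then have "\<not> (row_pos M i \<and> row_neg M i)"
      using \<open>j < p\<close> dim unfolding row_pos_def row_neg_def by fastforce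
    moreover have "\<not> row_pos M i \<and> \<not> row_neg M i" if "row_mixed M i"
      using that unfolding row_pos_def row_neg_def row_mixed_def by fastforce
    ultimately show ?thesis unfolding f_def by auto
  qed
  have f_proper: "f i \<noteq> f j" if ij: "i < p" "j < p" "{v i, v j} \<in> E" for i j
  proof -
    have ji: "{v j, v i} \<in> E" using ij by (simp add: insert_commute)
    have "row_types_compatible M i j \<or> row_types_compatible M j i"
      using uniform ij unfolding uniform_1_2_def by blast
    then show ?thesis
      using f_eq[OF ij] f_eq[OF ij(2,1) ji] unfolding row_types_compatible_def by auto
  qed
  define ix where "ix = inv_into {..<p} v"
  have ix: "ix u < p" "v (ix u) = u" if "u \<in> V" for u
    using that v inv_into_into[of u v "{..<p}"] f_inv_into_f[of u v "{..<p}"]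
    by (auto simp: ix_def)
  show ?thesis
    unfolding colorable_with_def
  proof (intro exI[of _ "f \<circ> ix"] conjI ballI impI)
    show "(f \<circ> ix) u < 3" for u by (simp add: f_def)
    show "(f \<circ> ix) u \<noteq> (f \<circ> ix) w" if "u \<in> V" "w \<in> V" "{u, w} \<in> E" for u w
      using f_proper[of "ix u" "ix w"] ix that by simp
  qed
qed

theorem proposition5:
  fixes V :: "'a set" and E :: "'a set set" and p :: nat and v :: "nat \<Rightarrow> 'a"
  assumes "simple_graph V E"
    and "bij_betw v {..<p} V"
  shows "(colorable_with V E 3 \<longleftrightarrow> has_uniform_1_2_da_matrix p v E) \<and>
         (\<not> colorable_with V E 2 \<longrightarrow>
            (three_colorable V E \<longleftrightarrow> has_uniform_1_2_da_matrix p v E))"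
proof -
  have "v ` {..<p} = V" using assms(2) by (rule bij_betw_imp_surj_on)
  then have "colorable_with V E 3 \<longleftrightarrow> has_uniform_1_2_da_matrix p v E"
    using uniform_matrix_if_colorable colorable_if_uniform_matrix by metis
  then show ?thesis by (simp add: three_colorable_def)
qed

end
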